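(* Let $A\in\mathbb{R}^{k_1\times k_2}$, $b_1\in\mathbb{R}^{k_1}$, $b_2\in\mathbb{R}^{k_2}$, $\eta>0$. Implicit Midpoint Gradient Descent (IMGD) with learning rate $\eta$ is obtained by applying the implicit midpoint rule with step size $\eta$ to the continuous-time gradient descent dynamics $\dot x=Gx+c$. That is, for $x^t,x^{t+1}\in\mathbb{R}^{k_1+k_2}$, $$x^{t+1}=x^t+\eta\left(G\,\frac{x^t+x^{t+1}}{2}+c\right)$$ holds if and only if $$x^{t+1}=\left(I-\tfrac{\eta}{2}G\right)^{-1}\left(\left(I+\tfrac{\eta}{2}G\right)x^t+\eta c\right).$$
   Context: The unconstrained bilinear zero-sum game has utilities $u_1(x_1,x_2)=x_1^\top A x_2+b_1^\top x_1-b_2^\top x_2$ and $u_2=-u_1$, $x_i\in\mathbb{R}^{k_i}$. With $x=(x_1,x_2)$, the gradient field is $(\nabla_{x_1}u_1(x),\nabla_{x_2}u_2(x))=Gx+c$, where $$G=\begin{pmatrix} 0 & A \\ -A^\top & 0 \end{pmatrix},\qquad c=\begin{pmatrix} b_1 \\ b_2 \end{pmatrix}.$$ IMGD is the iteration $x_i^{t+1}=x_i^t+\eta\,\frac{\nabla_{x_i}u_i(x^{t+1})+\nabla_{x_i}u_i(x^t)}{2}$, $i=1,2$, equivalently $x^{t+1}=(I-\tfrac{\eta}{2}G)^{-1}((I+\tfrac{\eta}{2}G)x^t+\eta c)$ (the inverse exists for every $\eta>0$). The implicit midpoint rule with step size $\eta$ for an ODE $\dot x=f(x)$ is $x^{t+1}=x^t+\eta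 f\!\left(\frac{x^t+x^{t+1}}{2}\right)$. *)

theory Defs
  imports "HOL-Analysis.Analysis"
begin

text \<open>
  A joint strategy \<open>x = (x\<^sub>1, x\<^sub>2)\<close> is a vector indexed by the disjoint sum of the two players'
  index types, so that the joint strategy space has dimension \<open>k\<^sub>1 + k\<^sub>2\<close>.
\<close>

definition join_vec :: "real^'k1 \<Rightarrow> real^'k2 \<Rightarrow> real^('k1::finite + 'k2::finite)" where
  "join_vec v w = (\<chi> i. case i of Inl a \<Rightarrow> v $ a | Inr b \<Rightarrow> w $ b)"

definition part1 :: "real^('k1::finite + 'k2::finite) \<Rightarrow> real^'k1" where
  "part1 x = (\<chi> a. x $ Inl a)"

definition part2 :: "real^('k1::finite + 'k2::finite) \<Rightarrow> real^'k2" where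
  "part2 x = (\<chi> b. x $ Inr b)"

definition u1 :: "real^'k2^'k1 \<Rightarrow> real^'k1 \<Rightarrow> real^'k2 \<Rightarrow> real^'k1 \<Rightarrow> real^'k2 \<Rightarrow> real" where
  "u1 A b1 b2 x1 x2 = x1 \<bullet> (A *v x2) + b1 \<bullet> x1 - b2 \<bullet> x2"

definition u2 :: "real^'k2^'k1 \<Rightarrow> real^'k1 \<Rightarrow> real^'k2 \<Rightarrow> real^'k1 \<Rightarrow> real^'k2 \<Rightarrow> real" where
  "u2 A b1 b2 x1 x2 = - u1 A b1 b2 x1 x2"

definition grad :: "('a::euclidean_space \<Rightarrow> real) \<Rightarrow> 'a \<Rightarrow> 'a" where
  "grad f x = (THE D. GDERIV f x :> D)"

text \<open>The block matrix with rows \<open>(0, A)\<close> and \<open>(- A\<^sup>T, 0)\<close>.\<close>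

definition game_matrix :: "real^'k2^'k1 \<Rightarrow> real^('k1::finite + 'k2::finite)^('k1 + 'k2)" where
  "game_matrix A = (\<chi> i j. case i of
      Inl a \<Rightarrow> (case j of Inl _ \<Rightarrow> 0 | Inr b \<Rightarrow> A $ a $ b)
    | Inr b \<Rightarrow> (case j of Inl a \<Rightarrow> - transpose A $ b $ a | Inr _ \<Rightarrow> 0))"

text \<open>
  Implicit schemes are given as the relation between the current iterate \<open>x\<close> and the next one \<open>y\<close>.
\<close>

definition implicit_midpoint_step :: "real \<Rightarrow> ('a::real_vector \<Rightarrow> 'a) \<Rightarrow> 'a \<Rightarrow> 'a \<Rightarrow> bool" where
  "implicit_midpoint_step \<eta> f x y \<longleftrightarrow> y = x + \<eta> *\<^sub>R f ((1 / 2) *\<^sub>R (x + y))"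

definition imgd_step ::
  "real \<Rightarrow> real^'k2^'k1 \<Rightarrow> real^'k1 \<Rightarrow> real^'k2 \<Rightarrow> real^('k1::finite + 'k2::finite) \<Rightarrow> real^('k1::finite + 'k2::finite) \<Rightarrow> bool" where
  "imgd_step \<eta> A b1 b2 x y \<longleftrightarrow>
     part1 y = part1 x + \<eta> *\<^sub>R ((1 / 2) *\<^sub>R
       (grad (\<lambda>z. u1 A b1 b2 z (part2 y)) (part1 y) + grad (\<lambda>z. u1 A b1 b2 z (part2 x)) (part1 x))) \<and>
     part2 y = part2 x + \<eta> *\<^sub>R ((1 / 2) *\<^sub>R
       (grad (\<lambda>z. u2 A b1 b2 (part1 y) z) (part2 y) + grad (\<lambda>z. u2 A b1 b2 (part1 x) z) (part2 x)))"

end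

theory Submission
  imports Defs
begin

text \<open>
  \<open>G\<close> is skew-symmetric, so \<open>z \<bullet> (G *v z) = 0\<close>: a vector \<open>z\<close> with \<open>(I - h G) z = 0\<close> satisfies
  \<open>z \<bullet> z = h (z \<bullet> G z) = 0\<close>, which makes \<open>I - h G\<close> invertible. Since the gradient field is affine,
  averaging it over two points is the same as evaluating it at their midpoint.
\<close>

lemma part1_part2_eq_iff: "x = y \<longleftrightarrow> part1 x = part1 y \<and> part2 x = part2 y"
proof
  assume *: "part1 x = part1 y \<and> part2 x = part2 y"
  have "x $ i = y $ i" for i
    using * by (cases i) (auto simp: part1_def part2_def vec_eq_iff)
  then show "x = y" by (simp add: vec_eq_iff)
qed simp

lemma part_add [simp]:
  "part1 (x + y) = part1 x + part1 y" "part2 (x + y) = part2 x + part2 y"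
  by (simp_all add: part1_def part2_def vec_eq_iff)

lemma part_scaleR [simp]:
  "part1 (r *\<^sub>R x) = r *\<^sub>R part1 x" "part2 (r *\<^sub>R x) = r *\<^sub>R part2 x"
  by (simp_all add: part1_def part2_def vec_eq_iff)

lemma part_join_vec [simp]: "part1 (join_vec v w) = v" "part2 (join_vec v w) = w"
  by (simp_all add: part1_def part2_def join_vec_def vec_eq_iff)

lemma sum_UNIV_sum_type:
  fixes f :: "'a::finite + 'b::finite \<Rightarrow> 'c::comm_monoid_add"
  shows "sum f UNIV = (\<Sum>a\<in>UNIV. f (Inl a)) + (\<Sum>b\<in>UNIV. f (Inr b))"
  unfolding UNIV_Plus_UNIV [symmetric] by (subst sum.Plus) auto

lemma part_game_matrix [simp]:
  fixes A :: "real^'k2^'k1"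
  shows "part1 (game_matrix A *v x) = A *v part2 x"
    and "part2 (game_matrix A *v x) = - (transpose A *v part1 x)"
  by (simp_all add: part1_def part2_def game_matrix_def matrix_vector_mult_def vec_eq_iff
      sum_UNIV_sum_type sum_negf)

lemma inner_parts: "x \<bullet> y = part1 x \<bullet> part1 y + part2 x \<bullet> part2 y"
  by (simp add: inner_vec_def part1_def part2_def sum_UNIV_sum_type)

text \<open>The blocks contribute \<open>part1 z \<bullet> (A *v part2 z)\<close> and
  \<open>- (part2 z \<bullet> (transpose A *v part1 z))\<close>, which cancel because
  \<open>transpose A\<close> is the adjoint of \<open>A\<close>.\<close>

lemma inner_game_matrix_self: "z \<bullet> (game_matrix A *v z) = 0"
  by (simp add: inner_parts dot_lmul_matrix [symmetric] inner_commute)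

lemma invertible_mat1_minus_skew:
  fixes M :: "real^'n^'n"
  assumes "\<And>z. z \<bullet> (M *v z) = 0"
  shows "invertible (mat 1 - h *\<^sub>R M)"
proof -
  have "z = 0" if "(mat 1 - h *\<^sub>R M) *v z = 0" for z
  proof -
    have "z = h *\<^sub>R (M *v z)"
      using that by (simp add: matrix_vector_mult_diff_rdistrib scaleR_matrix_vector_assoc)
    then have "z \<bullet> z = h * (z \<bullet> (M *v z))"
      by (metis inner_scaleR_right)
    then show "z = 0"
      using assms by simp
  qed
  \<comment> \<open>The matrix is square, so a trivial kernel gives a left inverse, and a left
    inverse suffices for invertibility.\<close>
  then show ?thesis
    by (simp add: invertible_left_inverse matrix_left_invertible_ker)
qed

lemma eq_matrix_inv_mult_iff:
  fixes M :: "real^'n^'n"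
  assumes "invertible M"
  shows "y = matrix_inv M *v v \<longleftrightarrow> M *v y = v"
proof -
  \<comment> \<open>\<open>matrix_inv\<close> is a choice among two-sided inverses, so it has these
    properties once one exists; each equation serves one direction of the equivalence.\<close>
  have "M ** matrix_inv M = mat 1" "matrix_inv M ** M = mat 1"
    using someI_ex [OF assms [unfolded invertible_def]] by (simp_all add: matrix_inv_def)
  then show ?thesis
    by (metis matrix_vector_mul_assoc matrix_vector_mul_lid)
qed

text \<open>Since \<open>grad\<close> is a definite description, uniqueness is needed too:
  derivatives are unique as linear functionals, and a functional
  \<open>\<lambda>h. h \<bullet> D\<close> determines \<open>D\<close>.\<close>

lemma grad_eqI:
  assumes "GDERIV f x :> D"
  shows "grad f x = D"
  unfolding grad_def
proof (rule the_equality)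
  fix E assume "GDERIV f x :> E"
  then have "(\<lambda>h. h \<bullet> E) = (\<lambda>h. h \<bullet> D)"
    using assms unfolding gderiv_def by (rule has_derivative_unique)
  then show "E = D"
    by (metis vector_eq_ldot)
qed fact

text \<open>With the opponent's strategy fixed, each utility is affine in the player's own strategy;
  \<open>r\<close> absorbs the terms that depend on the opponent alone.\<close>

lemma grad_affine: "grad (\<lambda>z. z \<bullet> v + r) x = v"
  by (rule grad_eqI) (auto simp: gderiv_def intro!: derivative_eq_intros)

lemma grad_u1: "grad (\<lambda>z. u1 A b1 b2 z x2) x1 = A *v x2 + b1"
  using grad_affine [of "A *v x2 + b1" "- (b2 \<bullet> x2)" x1]
  by (simp add: u1_def inner_add_right inner_commute)

lemma grad_u2: "grad (\<lambda>z. u2 A b1 b2 x1 z) x2 = - (transpose A *v x1) + b2"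
proof -
  \<comment> \<open>The adjoint moves \<open>A\<close> off \<open>z\<close>; negating
    \<open>u1\<close> gives \<open>transpose A\<close> its minus sign and makes the
    \<open>b2\<close> term positive.\<close>
  have "u2 A b1 b2 x1 z = z \<bullet> (- (transpose A *v x1) + b2) + - (b1 \<bullet> x1)" for z
    by (simp add: u2_def u1_def inner_add_right inner_diff_right dot_lmul_matrix [symmetric] inner_commute)
  then show ?thesis
    by (simp only: grad_affine)
qed

theorem proposition4:
  fixes A :: "real^'k2^'k1"
    and b1 :: "real^'k1"
    and b2 :: "real^'k2"
    and \<eta> :: real
    and x y :: "real^('k1::finite + 'k2::finite)"
  assumes "\<eta> > 0"
  defines "G \<equiv> game_matrix A"
    and "c \<equiv> join_vec b1 b2"
  shows "invertible (mat 1 - (\<eta> / 2) *\<^sub>R G)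
    \<and> (imgd_step \<eta> A b1 b2 x y \<longleftrightarrow> implicit_midpoint_step \<eta> (\<lambda>z. G *v z + c) x y)
    \<and> (implicit_midpoint_step \<eta> (\<lambda>z. G *v z + c) x y \<longleftrightarrow>
        y = matrix_inv (mat 1 - (\<eta> / 2) *\<^sub>R G) *v ((mat 1 + (\<eta> / 2) *\<^sub>R G) *v x + \<eta> *\<^sub>R c))"
proof (intro conjI)
  show inv: "invertible (mat 1 - (\<eta> / 2) *\<^sub>R G)"
    unfolding G_def by (rule invertible_mat1_minus_skew) (rule inner_game_matrix_self)
  show "imgd_step \<eta> A b1 b2 x y \<longleftrightarrow> implicit_midpoint_step \<eta> (\<lambda>z. G *v z + c) x y"
  proof -
    \<comment> \<open>Block by block, the averaged gradients become the gradient at the midpoint,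
      after which both step relations unfold to the same pair of equations.\<close>
    have 1: "(1 / 2) *\<^sub>R ((A *v part2 y + b1) + (A *v part2 x + b1)) =
        A *v ((1 / 2) *\<^sub>R (part2 x + part2 y)) + b1"
      by (simp add: matrix_vector_right_distrib matrix_vector_mult_scaleR vec_eq_iff field_simps)
    have 2: "(1 / 2) *\<^sub>R ((- (transpose A *v part1 y) + b2) + (- (transpose A *v part1 x) + b2)) =
        - (transpose A *v ((1 / 2) *\<^sub>R (part1 x + part1 y))) + b2"
      by (simp add: matrix_vector_right_distrib matrix_vector_mult_scaleR vec_eq_iff field_simps)
    show ?thesis
      unfolding imgd_step_def implicit_midpoint_step_def grad_u1 grad_u2 1 2 G_def c_def
        part1_part2_eq_iff [of y] part_add part_scaleR part_game_matrix part_join_vec ..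
  qed
  \<comment> \<open>The residual of the midpoint equation is regrouped with all \<open>y\<close>
    terms first; the step size times the midpoint's factor 1/2 gives \<open>\<eta> / 2\<close> on
    both sides.\<close>
  have "y - (x + \<eta> *\<^sub>R (G *v ((1 / 2) *\<^sub>R (x + y)) + c)) =
      (y - (\<eta> / 2) *\<^sub>R (G *v y)) - (x + (\<eta> / 2) *\<^sub>R (G *v x) + \<eta> *\<^sub>R c)"
    by (simp add: matrix_vector_right_distrib matrix_vector_mult_scaleR vec_eq_iff field_simps)
  then have "y = x + \<eta> *\<^sub>R (G *v ((1 / 2) *\<^sub>R (x + y)) + c) \<longleftrightarrow>
      y - (\<eta> / 2) *\<^sub>R (G *v y) = x + (\<eta> / 2) *\<^sub>R (G *v x) + \<eta> *\<^sub>R c"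
    by (metis eq_iff_diff_eq_0)
  then show "implicit_midpoint_step \<eta> (\<lambda>z. G *v z + c) x y \<longleftrightarrow>
      y = matrix_inv (mat 1 - (\<eta> / 2) *\<^sub>R G) *v ((mat 1 + (\<eta> / 2) *\<^sub>R G) *v x + \<eta> *\<^sub>R c)"
    \<comment> \<open>Clearing the inverse leaves a linear equation that matches the regrouped one
      after distributing the matrix sums.\<close>
    unfolding implicit_midpoint_step_def eq_matrix_inv_mult_iff [OF inv]
    by (simp add: matrix_vector_mult_diff_rdistrib matrix_vector_mult_add_rdistrib
        scaleR_matrix_vector_assoc)
qed

end
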